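(* Let $\mathfrak d,\mathfrak s,\mathfrak t\in\frac12\mathbb N$ with $\mathfrak s+\mathfrak t=\mathfrak d$. If $\frac{\mathfrak d}2\le\mathfrak s<\mathfrak d$, then $$P_{\frac{\mathfrak s}{\mathfrak d}}(\mathfrak S<\mathfrak s)\le P_{\frac{\mathfrak s}{\mathfrak d}}(\mathfrak S>\mathfrak s)\qquad\text{provided }\mathfrak s,\mathfrak t,\mathfrak d\in\mathbb N;\tag{i}$$ $$P^{b(\mathfrak s,\mathfrak t+1)}\left(\mathfrak B\ge\tfrac{\mathfrak s}{\mathfrak d}\right)\le P^{b(\mathfrak s+1,\mathfrak t)}\left(\mathfrak B\le\tfrac{\mathfrak s}{\mathfrak d}\right).\tag{ii}$$ Both (i) and (ii) are equivalent to $$e_{\mathfrak s,\mathfrak t}\le\frac{\mathfrak s}{\mathfrak d}.$$ We also have the lower bound $$\frac{\mathfrak s+1}{\mathfrak s+\mathfrak t+2}\le e_{\mathfrak s,\mathfrak t}$$ for real numbers $\mathfrak s\ge\mathfrak t\ge1$.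
   Context: $\frac12\mathbb N=\{n/2:n\in\mathbb N\}$, $\mathbb N=\{1,2,\dots\}$. For $\mathfrak d\in\mathbb N$ and $p\in[0,1]$, $P_p$ refers to a random variable $\mathfrak S$ with the binomial distribution, $P_p(\mathfrak S=k)=\binom{\mathfrak d}{k}p^k(1-p)^{\mathfrak d-k}$ ($\mathfrak d$ independent flips of a coin with probability $p$ of heads). For real $\alpha,\beta>0$, $P^{b(\alpha,\beta)}$ refers to a random variable $\mathfrak B$ with the Beta$(\alpha,\beta)$ distribution on $[0,1]$, i.e. with density $x^{\alpha-1}(1-x)^{\beta-1}/B(\alpha,\beta)$; its CDF is the regularized incomplete beta function $P^{b(\alpha,\beta)}(\mathfrak B\le x)=I_x(\alpha,\beta)$. For real $\mathfrak s,\mathfrak t>0$ the equipoint $e_{\mathfrak s,\mathfrak t}\in[0,1]$ is the unique number with $$P^{b(\mathfrak s+1,\mathfrak t)}(\mathfrak B\le e_{\mathfrak s,\mathfrak t})=P^{b(\mathfrak s,\mathfrak t+1)}(\mathfrak B\ge e_{\mathfrak s,\mathfrak t}),$$ equivalently $I_{e_{\mathfrak s,\mathfrak t}}(\mathfrak s,\mathfrak t+1)+I_{e_{\mathfrak s,\mathfrak t}}(\mathfrak s+1,\mathfrak t)=1$. *)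

theory Defs
  imports "HOL-Probability.Probability"
begin

text \<open>The naturals of the paper start at 1, so 0 is not a positive half-integer.\<close>

definition half_nats :: "real set" where
  "half_nats = {real n / 2 | n. n \<ge> 1}"

definition pos_nats :: "real set" where
  "pos_nats = {real n | n. n \<ge> 1}"

text \<open>The law of a Beta-distributed variable; it is a probability measure for
  \<open>\<alpha>, \<beta> > 0\<close>.\<close>

definition beta_density :: "real \<Rightarrow> real \<Rightarrow> real \<Rightarrow> real" where
  "beta_density \<alpha> \<beta> x =
     (if x \<in> {0..1} then x powr (\<alpha> - 1) * (1 - x) powr (\<beta> - 1) / Beta \<alpha> \<beta> else 0)"

definition beta_distr :: "real \<Rightarrow> real \<Rightarrow> real measure" where
  "beta_distr \<alpha> \<beta> = density lborel (\<lambda>x. ennreal (beta_density \<alpha> \<beta> x))"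

definition equipoint :: "real \<Rightarrow> real \<Rightarrow> real" where
  "equipoint s t = (THE e. e \<in> {0..1} \<and>
     measure (beta_distr (s + 1) t) {x. x \<le> e} = measure (beta_distr s (t + 1)) {x. x \<ge> e})"

end

theory Submission
  imports Defs "HOL-Real_Asymp.Real_Asymp"
begin

text \<open>
  Write \<open>I\<^sub>x(\<alpha>, \<beta>)\<close> for the regularized incomplete beta function, which is the distribution
  function of the Beta law, and put \<open>F(x) = I\<^sub>x(s, t + 1) + I\<^sub>x(s + 1, t)\<close>.  On \<open>[0, 1]\<close> this
  function is continuous and strictly increasing from \<open>0\<close> to \<open>2\<close>, and the equipoint is the
  solution of \<open>F(e) = 1\<close>.  So \<open>e \<le> x\<close> means \<open>1 \<le> F(x)\<close>, which is the comparison of the two beta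
  tails at \<open>x\<close>; as upper binomial tails are values of the incomplete beta function, it is also the
  comparison of the two binomial tails.  What remains are two inequalities for real \<open>s \<ge> t\<close>:
  \<open>F(s/d) \<ge> 1\<close> with \<open>d = s + t\<close> and \<open>t > 0\<close>, and \<open>F((s + 1)/(d + 2)) \<le> 1\<close> with \<open>t \<ge> 1\<close>.

  Both are proved by coupling.  From the point \<open>m\<close> in question, one point moves to the left until
  it reaches \<open>0\<close> and another one moves to the right until it reaches \<open>1\<close>.  The function
  \<open>F(left) + F(right)\<close> starts at \<open>2F(m)\<close> and ends at \<open>F(0) + F(1) = 2\<close>, so it suffices to compare
  these two values.

  For \<open>m = (s + 1)/(d + 2)\<close>, the points are reflections of each other in the logit scale
  \<open>ln (x/(1 - x))\<close> around \<open>m\<close>.  The density of \<open>F\<close> in that scale is pointwise larger on the right,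
  so the sum is nondecreasing and \<open>2F(m) \<le> 2\<close>.  The derivative of the logarithm of the ratio of
  the two densities is bounded below by \<open>s - t\<close> times a positive multiple of
  \<open>1/(d + 2) - 1/(2st + d)\<close>, which is nonnegative because \<open>st \<ge> 1\<close>.

  For \<open>m = p = s/d\<close> and \<open>s > t\<close> there is no such pointwise comparison: in the logit scale the left density is
  larger near \<open>p\<close>, but the right one is larger in the tails.  One compares with the weight \<open>W(x) = x\<^sup>s (1 - x)\<^sup>t\<close>, which has its maximum at
  \<open>p\<close>.  With \<open>q = t/d\<close>, the points are chosen so that the reciprocals of their distances from \<open>p\<close>
  are \<open>1/p + 1/v\<close> on the left and \<open>1/q + 1/v\<close> on the right; then the ratio \<open>F'/W'\<close> has opposite
  values \<open>\<plusminus>K r(v)\<close> at the two points, with \<open>K > 0\<close> constant and \<open>r(v) = 1 + 2pq/v\<close>.  Integration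
  by parts moves the derivative from \<open>W\<close> to \<open>r\<close>: the function
  \<open>2F(p) - F(left) - F(right) + K r(v) (W(left) - W(right))\<close> has the derivative
  \<open>K r'(v) (W(left) - W(right))\<close>.  Now \<open>r' < 0\<close>, and \<open>W(left) \<le> W(right)\<close> is an elementary
  inequality for logarithms, so this function is nondecreasing.  It tends to \<open>0\<close> for \<open>v \<rightarrow> 0\<close>,
  because \<open>W\<close> is stationary at \<open>p\<close>, and to \<open>2F(p) - 2\<close> for \<open>v \<rightarrow> \<infinity>\<close>.
\<close>

section \<open>The Beta distribution function\<close>

text \<open>The regularized incomplete beta function \<open>I\<^sub>x(a, b)\<close>, for \<open>x \<in> [0, 1]\<close>.\<close>
definition inc_beta :: "real \<Rightarrow> real \<Rightarrow> real \<Rightarrow> real" where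
  "inc_beta a b x = integral {0..x} (\<lambda>u. u powr (a - 1) * (1 - u) powr (b - 1)) / Beta a b"

lemma Beta_real_pos: "Beta a b > 0" if "a > 0" "b > 0" for a b :: real
  using that by (simp add: Beta_def Gamma_real_pos)

lemma beta_kernel_integrable:
  fixes a b :: real
  assumes "a > 0" "b > 0"
  shows "(\<lambda>u. u powr (a - 1) * (1 - u) powr (b - 1)) integrable_on {0..1}"
  using has_integral_Beta_real[OF assms] by blast

lemma inc_beta_0: "inc_beta a b 0 = 0"
  by (simp add: inc_beta_def)

lemma inc_beta_1:
  assumes "a > 0" "b > 0"
  shows "inc_beta a b 1 = 1"
  using has_integral_Beta_real[OF assms] Beta_real_pos[OF assms]
  by (simp add: inc_beta_def integral_unique)

lemma continuous_on_inc_beta: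
  assumes "a > 0" "b > 0"
  shows "continuous_on {0..1} (inc_beta a b)"
  unfolding inc_beta_def
  using indefinite_integral_continuous_1[OF beta_kernel_integrable[OF assms]] Beta_real_pos[OF assms]
  by (intro continuous_intros) auto

lemma DERIV_inc_beta:
  assumes "a > 0" "b > 0" "0 < x" "x < 1"
  shows "(inc_beta a b has_real_derivative x powr (a - 1) * (1 - x) powr (b - 1) / Beta a b) (at x)"
proof -
  let ?g = "\<lambda>u. u powr (a - 1) * (1 - u) powr (b - 1)"
  have "continuous (at x within {0..1}) ?g"
    using assms by (intro continuous_intros) auto
  then have "((\<lambda>u. integral {0..u} ?g) has_vector_derivative ?g x) (at x within {0..1})"
    using integral_has_vector_derivative_continuous_at
        [OF beta_kernel_integrable[OF assms(1,2)], of x "{}"] assms by auto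
  then have "((\<lambda>u. integral {0..u} ?g) has_real_derivative ?g x) (at x)"
    using assms at_within_Icc_at[of 0 x 1]
    by (simp add: has_real_derivative_iff_has_vector_derivative)
  then show ?thesis
    unfolding inc_beta_def by (rule DERIV_cdivide)
qed

lemma beta_density_borel [measurable]: "beta_density a b \<in> borel_measurable borel"
  unfolding beta_density_def[abs_def] by measurable

lemma beta_density_nonneg: "a > 0 \<Longrightarrow> b > 0 \<Longrightarrow> beta_density a b x \<ge> 0"
  using Beta_real_pos[of a b] by (simp add: beta_density_def)

text \<open>Gauge integrals of the unnormalized density compute probabilities; this links the
  Lebesgue-style definition of the Beta law to the differentiable function \<^const>\<open>inc_beta\<close>.\<close>

lemma measure_beta_distr_restrict:
  assumes "a > 0" "b > 0" "A \<in> sets borel"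
    and "((\<lambda>u. u powr (a - 1) * (1 - u) powr (b - 1)) has_integral I) ({0..1} \<inter> A)"
  shows "measure (beta_distr a b) A = I / Beta a b"
proof -
  let ?f = "\<lambda>x. beta_density a b x * indicator A x"
  have "((\<lambda>u. u powr (a - 1) * (1 - u) powr (b - 1) / Beta a b) has_integral I / Beta a b) ({0..1} \<inter> A)"
    using assms(4) by (rule has_integral_divide)
  then have "((\<lambda>x. if x \<in> {0..1} \<inter> A then x powr (a - 1) * (1 - x) powr (b - 1) / Beta a b else 0)
      has_integral I / Beta a b) UNIV"
    by (subst has_integral_restrict_UNIV)
  also have "(\<lambda>x. if x \<in> {0..1} \<inter> A then x powr (a - 1) * (1 - x) powr (b - 1) / Beta a b else 0) = ?f"
    by (auto simp: beta_density_def fun_eq_iff indicator_def)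
  finally have int: "(?f has_integral I / Beta a b) UNIV" .
  have nn: "0 \<le> ?f x" for x
    using beta_density_nonneg[OF assms(1,2)] by simp
  have "emeasure (beta_distr a b) A = (\<integral>\<^sup>+x. ennreal (beta_density a b x) * indicator A x \<partial>lborel)"
    unfolding beta_distr_def using assms(3) by (subst emeasure_density) auto
  also have "\<dots> = (\<integral>\<^sup>+x. ennreal (?f x) \<partial>lborel)"
    by (intro nn_integral_cong) (auto simp: indicator_def)
  also have "\<dots> = ennreal (I / Beta a b)"
    using assms(3) nn int by (intro nn_integral_has_integral_lborel) auto
  finally show ?thesis
    using has_integral_nonneg[OF int nn] by (simp add: measure_def)
qed

lemma beta_distr_atMost:
  assumes "a > 0" "b > 0" "e \<in> {0..1}"
  shows "measure (beta_distr a b) {x. x \<le> e} = inc_beta a b e"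
proof -
  have "{0..1} \<inter> {x. x \<le> e} = {0..e}"
    using assms by auto
  moreover have "(\<lambda>u. u powr (a - 1) * (1 - u) powr (b - 1)) integrable_on {0..e}"
    using assms(3) by (intro integrable_on_subinterval[OF beta_kernel_integrable[OF assms(1,2)]]) auto
  ultimately show ?thesis
    unfolding inc_beta_def
    by (intro measure_beta_distr_restrict assms) (auto intro: integrable_integral)
qed

lemma beta_distr_atLeast:
  assumes "a > 0" "b > 0" "e \<in> {0..1}"
  shows "measure (beta_distr a b) {x. x \<ge> e} = 1 - inc_beta a b e"
proof -
  let ?g = "\<lambda>u. u powr (a - 1) * (1 - u) powr (b - 1)"
  have "{0..1} \<inter> {x. x \<ge> e} = {e..1}"
    using assms by auto
  moreover have "?g integrable_on {e..1}"
    using assms(3) by (intro integrable_on_subinterval[OF beta_kernel_integrable[OF assms(1,2)]]) auto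
  ultimately have "measure (beta_distr a b) {x. x \<ge> e} = integral {e..1} ?g / Beta a b"
    by (intro measure_beta_distr_restrict assms) (auto intro: integrable_integral)
  also have "integral {0..e} ?g + integral {e..1} ?g = integral {0..1} ?g"
    using assms by (intro Henstock_Kurzweil_Integration.integral_combine beta_kernel_integrable) auto
  then have "integral {e..1} ?g = integral {0..1} ?g - integral {0..e} ?g"
    by simp
  also have "(integral {0..1} ?g - integral {0..e} ?g) / Beta a b = 1 - inc_beta a b e"
    using inc_beta_1[OF assms(1,2)] by (simp add: inc_beta_def diff_divide_distrib)
  finally show ?thesis .
qed

section \<open>The equipoint as the solution of a monotone equation\<close>

text \<open>Since the upper tail of Beta\<open>(s, t + 1)\<close> is \<open>1 - I\<^sub>x(s, t + 1)\<close>, the two tails at \<open>x\<close> are equal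
  exactly if this sum of two lower tails is \<open>1\<close>.\<close>
definition beta_tail_balance :: "real \<Rightarrow> real \<Rightarrow> real \<Rightarrow> real" where
  "beta_tail_balance s t x = inc_beta s (t + 1) x + inc_beta (s + 1) t x"

definition beta_weight :: "real \<Rightarrow> real \<Rightarrow> real \<Rightarrow> real" where
  "beta_weight s t x = x powr s * (1 - x) powr t"

lemma beta_tail_balance_0: "beta_tail_balance s t 0 = 0"
  by (simp add: beta_tail_balance_def inc_beta_0)

lemma beta_tail_balance_1: "s > 0 \<Longrightarrow> t > 0 \<Longrightarrow> beta_tail_balance s t 1 = 2"
  by (simp add: beta_tail_balance_def inc_beta_1)

lemma continuous_on_beta_tail_balance:
  "s > 0 \<Longrightarrow> t > 0 \<Longrightarrow> continuous_on {0..1} (beta_tail_balance s t)"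
  unfolding beta_tail_balance_def by (intro continuous_on_add continuous_on_inc_beta) auto

lemma beta_weight_pos: "0 < x \<Longrightarrow> x < 1 \<Longrightarrow> beta_weight s t x > 0"
  by (simp add: beta_weight_def)

lemma continuous_on_beta_weight:
  "s > 0 \<Longrightarrow> t > 0 \<Longrightarrow> continuous_on {0..1} (beta_weight s t)"
  unfolding beta_weight_def[abs_def] by (intro continuous_intros continuous_on_powr') auto

lemma DERIV_beta_weight:
  assumes "0 < x" "x < 1"
  shows "(beta_weight s t has_real_derivative
           beta_weight s t x * (s - (s + t) * x) / (x * (1 - x))) (at x)"
  unfolding beta_weight_def
  by (rule derivative_eq_intros refl | use assms in force)+
     (use assms in \<open>simp add: powr_diff divide_simps, simp add: algebra_simps\<close>)

text \<open>By the recurrences for the beta function, the two densities have the same normalizing constant up to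
  the factors \<open>t\<close> and \<open>s\<close>.  The derivative is expressed through \<^const>\<open>beta_weight\<close> in order to
  share the factor \<open>W(x) / (x (1 - x))\<close> with the derivative of the weight itself.\<close>

lemma DERIV_beta_tail_balance:
  assumes "s > 0" "t > 0" "0 < x" "x < 1"
  shows "(beta_tail_balance s t has_real_derivative
           (s + t) / (s * t * Beta s t) * (beta_weight s t x * (s * (1 - x) + t * x) / (x * (1 - x)))) (at x)"
proof -
  have pos: "s \<notin> \<int>\<^sub>\<le>\<^sub>0" "t \<notin> \<int>\<^sub>\<le>\<^sub>0"
    using assms by (auto dest: nonpos_Ints_nonpos)
  have 1: "Beta s (t + 1) = t * Beta s t / (s + t)"
    using Beta_plus1_right[OF pos(2), of s] assms by (simp add: field_simps)
  have 2: "Beta (s + 1) t = s * Beta s t / (s + t)"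
    using Beta_plus1_left[OF pos(1), of t] assms by (simp add: field_simps)
  have B: "Beta s t > 0" using assms by (simp add: Beta_real_pos)
  have "(beta_tail_balance s t has_real_derivative
     x powr (s - 1) * (1 - x) powr (t + 1 - 1) / Beta s (t + 1) +
     x powr (s + 1 - 1) * (1 - x) powr (t - 1) / Beta (s + 1) t) (at x)"
    unfolding beta_tail_balance_def using assms
    by (intro DERIV_add DERIV_inc_beta) auto
  also have "x powr (s - 1) * (1 - x) powr (t + 1 - 1) / Beta s (t + 1) +
     x powr (s + 1 - 1) * (1 - x) powr (t - 1) / Beta (s + 1) t =
     (s + t) / (s * t * Beta s t) * (beta_weight s t x * (s * (1 - x) + t * x) / (x * (1 - x)))"
    using assms B unfolding 1 2 beta_weight_def
    by (simp add: powr_diff divide_simps, simp add: algebra_simps)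
  finally show ?thesis .
qed

lemma beta_tail_balance_strict_mono:
  assumes "s > 0" "t > 0"
  shows "strict_mono_on {0..1} (beta_tail_balance s t)"
proof (rule strict_mono_onI)
  fix x y :: real assume xy: "x \<in> {0..1}" "y \<in> {0..1}" "x < y"
  show "beta_tail_balance s t x < beta_tail_balance s t y"
  proof (rule DERIV_pos_imp_increasing_open[OF xy(3)])
    fix z assume z: "x < z" "z < y"
    then have z01: "0 < z" "z < 1" using xy by auto
    have "0 < s * (1 - z) + t * z"
      using assms z01 by (intro add_pos_pos mult_pos_pos) auto
    then have "0 < (s + t) / (s * t * Beta s t) * (beta_weight s t z * (s * (1 - z) + t * z) / (z * (1 - z)))"
      using assms z01 Beta_real_pos[of s t] beta_weight_pos[of z s t]
      by (intro mult_pos_pos divide_pos_pos) auto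
    with DERIV_beta_tail_balance[OF assms z01]
    show "\<exists>D. DERIV (beta_tail_balance s t) z :> D \<and> 0 < D" by blast
  next
    show "continuous_on {x..y} (beta_tail_balance s t)"
      using continuous_on_beta_tail_balance[OF assms] xy by (rule_tac continuous_on_subset) auto
  qed
qed

lemma equipoint_balances:
  assumes "s > 0" "t > 0"
  shows "equipoint s t \<in> {0..1} \<and> beta_tail_balance s t (equipoint s t) = 1"
proof -
  have eq: "(e \<in> {0..1} \<and> measure (beta_distr (s + 1) t) {x. x \<le> e} = measure (beta_distr s (t + 1)) {x. x \<ge> e})
      \<longleftrightarrow> (e \<in> {0..1} \<and> beta_tail_balance s t e = 1)" for e
    using assms beta_distr_atMost[of "s+1" t e] beta_distr_atLeast[of s "t+1" e]
    by (auto simp: beta_tail_balance_def)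
  have "\<exists>e. 0 \<le> e \<and> e \<le> 1 \<and> beta_tail_balance s t e = 1"
    using assms continuous_on_beta_tail_balance[OF assms]
    by (intro IVT') (auto simp: beta_tail_balance_0 beta_tail_balance_1)
  moreover have "e = e'" if "e \<in> {0..1}" "e' \<in> {0..1}" "beta_tail_balance s t e = 1" "beta_tail_balance s t e' = 1" for e e'
    using strict_mono_on_imp_inj_on[OF beta_tail_balance_strict_mono[OF assms]] that
    by (metis inj_onD)
  ultimately have "\<exists>!e. e \<in> {0..1} \<and> beta_tail_balance s t e = 1"
    by auto
  then show ?thesis
    unfolding equipoint_def eq by (rule theI')
qed

lemma equipoint_le_iff:
  assumes "s > 0" "t > 0" "x \<in> {0..1}"
  shows "equipoint s t \<le> x \<longleftrightarrow> 1 \<le> beta_tail_balance s t x"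
  using strict_mono_on_less_eq[OF beta_tail_balance_strict_mono[OF assms(1,2)], of "equipoint s t" x]
    equipoint_balances[OF assms(1,2)] assms(3) by auto

lemma le_equipoint_iff:
  assumes "s > 0" "t > 0" "x \<in> {0..1}"
  shows "x \<le> equipoint s t \<longleftrightarrow> beta_tail_balance s t x \<le> 1"
  using strict_mono_on_less_eq[OF beta_tail_balance_strict_mono[OF assms(1,2)], of x "equipoint s t"]
    equipoint_balances[OF assms(1,2)] assms(3) by auto

lemma beta_tails_le_iff:
  assumes "s > 0" "t > 0" "x \<in> {0..1}"
  shows "measure (beta_distr s (t + 1)) {y. y \<ge> x} \<le> measure (beta_distr (s + 1) t) {y. y \<le> x}
     \<longleftrightarrow> 1 \<le> beta_tail_balance s t x"
  using assms by (auto simp: beta_distr_atMost beta_distr_atLeast beta_tail_balance_def)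

section \<open>Binomial tails\<close>

text \<open>As a function of the success probability, an upper binomial tail has a telescoping derivative of
  which only the first term survives, and that term is a Beta density.\<close>

lemma binomial_upper_sum_eq_inc_beta:
  fixes n k :: nat and x :: real
  assumes k: "1 \<le> k" "k \<le> n" and x: "0 \<le> x" "x \<le> 1"
  shows "(\<Sum>j=k..n. real (n choose j) * x ^ j * (1 - x) ^ (n - j)) = inc_beta (real k) (real (n - k) + 1) x"
proof (cases "x = 0")
  case True
  then show ?thesis using k by (auto simp: inc_beta_0 intro!: sum.neutral)
next
  case False
  define T where "T = (\<lambda>x::real. \<Sum>j=k..n. real (n choose j) * x ^ j * (1 - x) ^ (n - j))"
  define U where "U = (\<lambda>(y::real) j. real j * real (n choose j) * y ^ (j - 1) * (1 - y) ^ (n - j))"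
  \<comment> \<open>The first surviving term \<open>U y k\<close> carries the factor \<open>k (n choose k)\<close>, the reciprocal of this beta value.\<close>
  have B: "Beta (real k) (real (n - k) + 1) = 1 / (real k * real (n choose k))"
  proof -
    have "Gamma (real k) = fact (k - 1)"
      using k Gamma_fact[of "k - 1", where ?'a = real] by (simp add: of_nat_diff)
    moreover have "Gamma (real (n - k) + 1) = fact (n - k)"
      using Gamma_fact[of "n - k", where ?'a = real] by (simp add: add.commute)
    moreover have "Gamma (real k + (real (n - k) + 1)) = fact n"
      using k Gamma_fact[of "n", where ?'a = real] by (simp add: of_nat_diff algebra_simps)
    moreover have "(fact k::real) = real k * fact (k - 1)"
      using k by (subst fact_reduce) auto
    ultimately show ?thesis
      using k by (simp add: Beta_def binomial_fact field_simps)
  qed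
  have derT: "DERIV T y :> U y k" for y
  proof -
    have term_deriv: "DERIV (\<lambda>x. real (n choose j) * x ^ j * (1 - x) ^ (n - j)) y :> U y j - U y (Suc j)"
      if "j \<in> {k..n}" for j
    proof -
      have "Suc j * (n choose Suc j) = (n - j) * (n choose j)"
        using binomial_absorb_comp[of n j] binomial_absorption[of j n] by simp
      then have "real (Suc j) * real (n choose Suc j) = real (n - j) * real (n choose j)"
        by (metis of_nat_mult)
      then have "U y (Suc j) = real (n - j) * real (n choose j) * y ^ j * (1 - y) ^ (n - j - 1)"
        by (simp add: U_def)
      then show ?thesis
        unfolding U_def
        by (auto intro!: derivative_eq_intros simp: U_def algebra_simps)
    qed
    have "DERIV T y :> (\<Sum>j=k..n. U y j - U y (Suc j))"
      unfolding T_def by (rule DERIV_sum) (use term_deriv in auto)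
    also have "(\<Sum>j=k..n. U y j - U y (Suc j)) = U y k - U y (Suc n)"
      using k sum_Suc_diff[of k "Suc n" "\<lambda>j. - U y j"]
      by (simp add: sum_Suc_diff)
    also have "U y (Suc n) = 0" by (simp add: U_def)
    finally show ?thesis by simp
  qed
  have "T x - inc_beta (real k) (real (n - k) + 1) x = T 0 - inc_beta (real k) (real (n - k) + 1) 0"
  proof (rule DERIV_isconst_end[where f = "\<lambda>x. T x - inc_beta (real k) (real (n - k) + 1) x"])
    show "0 < x" using False x by simp
    have "continuous_on {0..x} T"
      using derT by (intro DERIV_continuous_on) (auto intro: has_field_derivative_at_within)
    moreover have "continuous_on {0..x} (inc_beta (real k) (real (n - k) + 1))"
      using x k by (intro continuous_on_subset[OF continuous_on_inc_beta]) auto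
    ultimately show "continuous_on {0..x} (\<lambda>x. T x - inc_beta (real k) (real (n - k) + 1) x)"
      by (rule continuous_on_diff)
  next
    fix y assume y: "0 < y" "y < x"
    have "y powr (real k - 1) = y ^ (k - 1)" "(1 - y) powr (real n - real k) = (1 - y) ^ (n - k)"
      using powr_realpow[of y "k - 1"] powr_realpow[of "1 - y" "n - k"] y x k
      by (simp_all add: of_nat_diff)
    then have "y powr (real k - 1) * (1 - y) powr (real (n - k) + 1 - 1) / Beta (real k) (real (n - k) + 1) = U y k"
      using k unfolding B U_def by (simp add: of_nat_diff)
    then show "DERIV (\<lambda>x. T x - inc_beta (real k) (real (n - k) + 1) x) y :> 0"
      using DERIV_diff[OF derT[of y] DERIV_inc_beta[of "real k" "real (n - k) + 1" y]] y x k by auto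
  qed
  moreover have "T 0 = 0"
    using k by (auto simp: T_def intro!: sum.neutral)
  ultimately show ?thesis by (simp add: T_def inc_beta_0)
qed

lemma prob_binomial_ge:
  assumes k: "1 \<le> k" "k \<le> n" and x: "0 \<le> x" "x \<le> 1"
  shows "measure_pmf.prob (binomial_pmf n x) {k..} = inc_beta (real k) (real (n - k) + 1) x"
proof -
  have "measure_pmf.prob (binomial_pmf n x) {k..} = measure_pmf.prob (binomial_pmf n x) {k..n}"
    using x by (intro measure_prob_cong_0) auto
  also have "\<dots> = (\<Sum>j=k..n. real (n choose j) * x ^ j * (1 - x) ^ (n - j))"
    using x by (subst measure_measure_pmf_finite) auto
  finally show ?thesis using binomial_upper_sum_eq_inc_beta[OF assms] by simp
qed

text \<open>The event \<open>S < i\<close> is complementary to \<open>S \<ge> i\<close> and \<open>S > i\<close> is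
  \<open>S \<ge> i + 1\<close>.  Their incomplete beta functions are the two summands of the balance.\<close>

lemma binomial_tails_le_iff:
  fixes i j n :: nat
  assumes ij: "1 \<le> i" "1 \<le> j" and n: "n = i + j" and x: "0 \<le> x" "x \<le> 1"
  shows "measure_pmf.prob (binomial_pmf n x) {k. real k < real i}
       \<le> measure_pmf.prob (binomial_pmf n x) {k. real k > real i}
     \<longleftrightarrow> 1 \<le> beta_tail_balance (real i) (real j) x"
proof -
  have "{k. real k < real i} = UNIV - {i..}" "{k. real k > real i} = {Suc i..}"
    by auto
  moreover have "measure_pmf.prob (binomial_pmf n x) (UNIV - {i..}) = 1 - measure_pmf.prob (binomial_pmf n x) {i..}"
    using measure_pmf.prob_compl[of "{i..}" "binomial_pmf n x"] by simp
  moreover have "measure_pmf.prob (binomial_pmf n x) {i..} = inc_beta (real i) (real j + 1) x"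
    using prob_binomial_ge[of i n x] ij n x by simp
  moreover have "measure_pmf.prob (binomial_pmf n x) {Suc i..} = inc_beta (real i + 1) (real j) x"
  proof -
    have "real (n - Suc i) + 1 = real j" "real (Suc i) = real i + 1"
      using ij n by auto
    then show ?thesis
      using prob_binomial_ge[of "Suc i" n x] ij n x by (simp add: add.commute)
  qed
  ultimately have
    "measure_pmf.prob (binomial_pmf n x) {k. real k < real i} = 1 - inc_beta (real i) (real j + 1) x"
    "measure_pmf.prob (binomial_pmf n x) {k. real k > real i} = inc_beta (real i + 1) (real j) x"
    by (simp_all only:)
  then show ?thesis
    unfolding beta_tail_balance_def by linarith
qed

section \<open>The balance at the mean\<close>

text \<open>Both couplings below are parametrized by a half-line, and their endpoints are only reached as limits.\<close>

lemma nondecreasing_limits_le: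
  fixes f :: "real \<Rightarrow> real"
  assumes der: "\<And>v. v > c \<Longrightarrow> \<exists>D. DERIV f v :> D \<and> D \<ge> 0"
    and a: "(f \<longlongrightarrow> a) (at_right c)" and b: "(f \<longlongrightarrow> b) at_top"
  shows "a \<le> b"
proof -
  have mono: "f u \<le> f v" if "c < u" "u \<le> v" for u v
    by (rule DERIV_nonneg_imp_nondecreasing) (use der that in auto)
  have "a \<le> f v" if "v > c" for v
  proof (rule tendsto_upperbound[OF a])
    show "eventually (\<lambda>u. f u \<le> f v) (at_right c)"
      using eventually_at_right_less[of c] eventually_at_right_real[OF that]
      by eventually_elim (use mono in auto)
  qed simp
  then have "eventually (\<lambda>v. a \<le> f v) at_top"
    by (rule eventually_mono[OF eventually_gt_at_top[of c]])
  then show ?thesis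
    by (rule tendsto_lowerbound[OF b]) simp
qed

text \<open>
  The numbers \<open>p = s/(s + t)\<close> and \<open>q = 1 - p\<close> are the distances from the mean to \<open>0\<close> and to \<open>1\<close>.
  The left and the right point below have distances \<open>pv/(v + p)\<close> and \<open>qv/(v + q)\<close> from \<open>p\<close>, that is,
  the reciprocals of the distances are \<open>1/p + 1/v\<close> and \<open>1/q + 1/v\<close>.  The points leave \<open>p\<close> at \<open>v = 0\<close>
  and reach \<open>0\<close> and \<open>1\<close> for \<open>v \<rightarrow> \<infinity>\<close>.
\<close>
locale mean_coupling =
  fixes p q :: real
  assumes q_pos: "0 < q" and q_le_p: "q \<le> p" and p_plus_q: "p + q = 1"
begin

definition lower_pt :: "real \<Rightarrow> real" where "lower_pt v = p\<^sup>2 / (v + p)"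
definition upper_pt :: "real \<Rightarrow> real" where "upper_pt v = (v + p * q) / (v + q)"

lemma p_pos: "0 < p" using q_pos q_le_p by simp

lemma q_eq: "q = 1 - p" using p_plus_q by simp

lemma one_minus_lower_pt: "v \<ge> 0 \<Longrightarrow> 1 - lower_pt v = (v + p * q) / (v + p)"
  using p_pos by (simp add: lower_pt_def q_eq divide_simps) (simp add: algebra_simps power2_eq_square)

lemma one_minus_upper_pt: "v \<ge> 0 \<Longrightarrow> 1 - upper_pt v = q\<^sup>2 / (v + q)"
proof -
  assume v: "v \<ge> 0"
  have "v + q - (v + p * q) = q\<^sup>2" by (simp add: q_eq algebra_simps power2_eq_square)
  then show ?thesis using v q_pos by (simp add: upper_pt_def field_simps)
qed

lemma lower_pt_bounds: "v \<ge> 0 \<Longrightarrow> 0 < lower_pt v" "v \<ge> 0 \<Longrightarrow> lower_pt v < 1"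
proof -
  assume v: "v \<ge> 0"
  show "0 < lower_pt v" using v p_pos by (simp add: lower_pt_def)
  have "0 < 1 - lower_pt v"
    unfolding one_minus_lower_pt[OF v] using v p_pos q_pos by (intro divide_pos_pos add_nonneg_pos) auto
  then show "lower_pt v < 1" by simp
qed

lemma upper_pt_bounds: "v \<ge> 0 \<Longrightarrow> 0 < upper_pt v" "v \<ge> 0 \<Longrightarrow> upper_pt v < 1"
proof -
  assume v: "v \<ge> 0"
  show "0 < upper_pt v" unfolding upper_pt_def 
    using v p_pos q_pos by (intro divide_pos_pos add_nonneg_pos) auto
  have "0 < 1 - upper_pt v"
    unfolding one_minus_upper_pt[OF v] using v q_pos by simp
  then show "upper_pt v < 1" by simp
qed

lemma coupling_at_0: "lower_pt 0 = p" "upper_pt 0 = p"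
  using p_pos q_pos by (auto simp: lower_pt_def upper_pt_def power2_eq_square)

lemma coupling_tendsto_0:
  "(lower_pt \<longlongrightarrow> p) (at_right 0)" "(upper_pt \<longlongrightarrow> p) (at_right 0)"
  unfolding lower_pt_def upper_pt_def
  by (rule tendsto_eq_intros refl | use p_pos q_pos in \<open>simp add: power2_eq_square\<close>)+

lemma coupling_tendsto_top: "(lower_pt \<longlongrightarrow> 0) at_top" "(upper_pt \<longlongrightarrow> 1) at_top"
  unfolding lower_pt_def upper_pt_def using p_pos q_pos by real_asymp+

lemma DERIV_lower_pt: "v \<ge> 0 \<Longrightarrow> DERIV lower_pt v :> - (p\<^sup>2 / (v + p)\<^sup>2)"
  unfolding lower_pt_def
  by (rule derivative_eq_intros refl | use p_pos in force)+
     (simp add: power2_eq_square)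

lemma DERIV_upper_pt: "v \<ge> 0 \<Longrightarrow> DERIV upper_pt v :> q\<^sup>2 / (v + q)\<^sup>2"
proof -
  assume v: "v \<ge> 0"
  have "DERIV upper_pt v :> (1 * (v + q) - (v + p * q) * 1) / ((v + q) * (v + q))"
    unfolding upper_pt_def
    by (rule derivative_eq_intros refl | use q_pos v in force)+
  also have "1 * (v + q) - (v + p * q) * 1 = q\<^sup>2"
    by (simp add: q_eq algebra_simps power2_eq_square)
  finally show ?thesis by (simp add: power2_eq_square)
qed

text \<open>The coupling is chosen for the sake of the next two identities.  At a point \<open>x\<close>, the derivatives \<open>F'\<close> and
  \<open>W'\<close> are proportional to \<open>p (1 - x) + q x\<close> and \<open>p - x\<close> with the common factor \<open>W(x) / (x (1 - x))\<close>, so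
  \<open>F'/W'\<close> has opposite values at the two points.\<close>

lemma balance_factor_lower:
  "v > 0 \<Longrightarrow> p * (1 - lower_pt v) + q * lower_pt v = (1 + 2 * p * q / v) * (p - lower_pt v)"
  using p_pos by (simp add: lower_pt_def q_eq divide_simps) (simp add: algebra_simps power2_eq_square)

lemma balance_factor_upper:
  "v > 0 \<Longrightarrow> p * (1 - upper_pt v) + q * upper_pt v = - ((1 + 2 * p * q / v) * (p - upper_pt v))"
proof -
  assume v: "v > 0"
  then have "v + q \<noteq> 0" using q_pos by simp
  then have "v + (1 - p) \<noteq> 0" by (simp add: q_eq)
  with v show ?thesis
    unfolding upper_pt_def unfolding q_eq by (simp add: divide_simps) (simp add: algebra_simps power2_eq_square)
qed

text \<open>The difference of the two sides vanishes at \<open>v = 0\<close>.  Since \<open>(v + p)(v + q) = v\<^sup>2 + v + pq\<close>, its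
  derivative collapses to \<open>(p - q) v\<^sup>2 / ((v + pq) (v + q) (v + p))\<close>, which is nonnegative.\<close>

lemma log_weight_le:
  assumes "v \<ge> 0"
  shows "p * ln (lower_pt v) + q * ln (1 - lower_pt v) \<le> p * ln (upper_pt v) + q * ln (1 - upper_pt v)"
proof -
  \<comment> \<open>This is right-hand side minus left-hand side, up to the additive constant \<open>2q ln q - 2p ln p\<close>.\<close>
  define G where "G = (\<lambda>v. (p - q) * ln (v + p * q) - ln (v + q) + ln (v + p))"
  have pq: "0 < p * q" using p_pos q_pos by simp
  have "G 0 \<le> G v"
  proof (rule DERIV_nonneg_imp_nondecreasing[OF assms])
    fix y :: real assume y: "0 \<le> y"
    have pos: "y + p > 0" "y + q > 0" "y + p * q > 0" using y p_pos q_pos pq by (auto intro: add_nonneg_pos)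
    have "DERIV G y :> (p - q) / (y + p * q) - 1 / (y + q) + 1 / (y + p)"
      unfolding G_def by (rule derivative_eq_intros refl | use pos in force)+
    moreover have "(p - q) / (y + p * q) - 1 / (y + q) + 1 / (y + p)
        = (p - q) * y\<^sup>2 / ((y + p * q) * (y + q) * (y + p))"
    proof -
      have e: "(y + q) * (y + p) = y\<^sup>2 + y + p * q"
        by (simp add: q_eq algebra_simps power2_eq_square)
      have "1 / (y + p) - 1 / (y + q) = - (p - q) / ((y + q) * (y + p))"
        using pos by (simp add: field_simps)
      then have "1 / (y + p) = 1 / (y + q) - (p - q) / ((y + q) * (y + p))"
        using minus_divide_left[of "p - q" "(y + q) * (y + p)"] by linarith
      then have "(p - q) / (y + p * q) - 1 / (y + q) + 1 / (y + p)
          = (p - q) * (1 / (y + p * q) - 1 / ((y + q) * (y + p)))"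
        by (simp add: right_diff_distrib)
      also have "1 / (y + p * q) - 1 / ((y + q) * (y + p)) = y\<^sup>2 / ((y + p * q) * ((y + q) * (y + p)))"
      proof -
        have "(y + q) * (y + p) \<noteq> 0" using pos by simp
        then show ?thesis using pos(3) e by (simp add: diff_frac_eq)
      qed
      finally show ?thesis by (simp add: mult.assoc)
    qed
    moreover have "(p - q) * y\<^sup>2 / ((y + p * q) * (y + q) * (y + p)) \<ge> 0"
      using pos q_le_p by (intro divide_nonneg_nonneg mult_nonneg_nonneg) auto
    ultimately show "\<exists>D. DERIV G y :> D \<and> D \<ge> 0" by auto
  qed
  moreover have "G 0 = 2 * p * ln p - 2 * q * ln q"
  proof -
    have "G 0 = (p - q) * (ln p + ln q) - ln q * (p + q) + ln p * (p + q)"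
      using p_pos q_pos p_plus_q by (simp add: G_def ln_mult)
    then show ?thesis by (simp add: algebra_simps)
  qed
  moreover have "G v = (p - q) * ln (v + p * q) - ln (v + q) * (p + q) + ln (v + p) * (p + q)"
    by (simp add: G_def p_plus_q)
  ultimately have "2 * p * ln p - 2 * q * ln q
      \<le> (p - q) * ln (v + p * q) - ln (v + q) * (p + q) + ln (v + p) * (p + q)"
    by simp
  moreover have logs: "ln (lower_pt v) = 2 * ln p - ln (v + p)" "ln (1 - upper_pt v) = 2 * ln q - ln (v + q)"
    "ln (1 - lower_pt v) = ln (v + p * q) - ln (v + p)" "ln (upper_pt v) = ln (v + p * q) - ln (v + q)"
    unfolding one_minus_lower_pt[OF assms] one_minus_upper_pt[OF assms] 
    unfolding lower_pt_def upper_pt_def using assms p_pos q_pos add_nonneg_pos[OF assms pq]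
    by (auto simp: ln_div ln_realpow)
  ultimately show ?thesis unfolding logs by (simp add: algebra_simps)
qed

lemma weight_le:
  assumes "v \<ge> 0" "d > 0"
  shows "beta_weight (d * p) (d * q) (lower_pt v) \<le> beta_weight (d * p) (d * q) (upper_pt v)"
proof -
  have "beta_weight (d * p) (d * q) x = exp (d * (p * ln x + q * ln (1 - x)))" if "0 < x" "x < 1" for x
    using that by (simp add: beta_weight_def powr_def distrib_left mult.assoc flip: exp_add)
  then show ?thesis
    using log_weight_le[OF assms(1)] lower_pt_bounds[OF assms(1)] upper_pt_bounds[OF assms(1)] assms(2)
    by simp
qed

end

text \<open>The integration by parts along the coupling takes the form that the auxiliary function \<open>H\<close> is
  nondecreasing.  The boundary term \<open>K r (W(left) - W(right))\<close> vanishes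
  at both ends: for \<open>v \<rightarrow> \<infinity>\<close> because \<open>W\<close> is zero at \<open>0\<close> and at \<open>1\<close>, and for \<open>v \<rightarrow> 0\<close>, although \<open>r\<close> has a
  pole there, because \<open>W\<close> is stationary at \<open>p\<close>.\<close>

lemma beta_tail_balance_at_mean_ge_1:
  assumes st: "t > 0" "s \<ge> t"
  shows "1 \<le> beta_tail_balance s t (s / (s + t))"
proof -
  define d p q where "d = s + t" and "p = s / d" and "q = t / d"
  have d: "d > 0" using st by (simp add: d_def)
  interpret mean_coupling p q
  proof
    show "0 < q" "q \<le> p" using st d by (auto simp: p_def q_def divide_right_mono)
    show "p + q = 1" using d by (simp add: p_def q_def d_def flip: add_divide_distrib)
  qed
  have s: "s = d * p" and t: "t = d * q" using d by (auto simp: p_def q_def)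
  have s0: "s > 0" using st by simp
  define F where "F = beta_tail_balance s t"
  define W where "W = beta_weight s t"
  define K where "K = d / (s * t * Beta s t)"
  define r where "r = (\<lambda>v. 1 + 2 * p * q / v)"
  define W' where "W' = (\<lambda>x. W x * (s - d * x) / (x * (1 - x)))"
  define H where "H = (\<lambda>v. 2 * F p - F (lower_pt v) - F (upper_pt v) + K * (r v * (W (lower_pt v) - W (upper_pt v))))"
  have K: "K \<ge> 0" using s0 st d Beta_real_pos[of s t] by (simp add: K_def)
  have pq: "p \<in> {0<..<1}" using p_pos q_pos p_plus_q by auto
  have derW: "DERIV W x :> W' x" if "0 < x" "x < 1" for x
    using DERIV_beta_weight[OF that, of s t] by (simp add: W_def W'_def d_def)
  have derF: "DERIV F x :> K * (W x * (d * (p * (1 - x) + q * x)) / (x * (1 - x)))" if "0 < x" "x < 1" for x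
  proof -
    have "d * (p * (1 - x) + q * x) = s * (1 - x) + t * x" by (simp add: s t algebra_simps)
    then show ?thesis
      using DERIV_beta_tail_balance[OF s0 st(1) that] unfolding F_def W_def K_def d_def by simp
  qed
  have derF_lower: "DERIV F (lower_pt v) :> K * (r v * W' (lower_pt v))" if "v > 0" for v
  proof -
    have "d * (p * (1 - lower_pt v) + q * lower_pt v) = d * (r v * (p - lower_pt v))"
      unfolding balance_factor_lower[OF that] r_def by simp
    also have "\<dots> = r v * (s - d * lower_pt v)"
      by (simp add: s algebra_simps)
    finally show ?thesis
      using derF[of "lower_pt v"] lower_pt_bounds[of v] that by (simp add: W'_def mult_ac)
  qed
  have derF_upper: "DERIV F (upper_pt v) :> - (K * (r v * W' (upper_pt v)))" if "v > 0" for v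
  proof -
    have "d * (p * (1 - upper_pt v) + q * upper_pt v) = - (d * (r v * (p - upper_pt v)))"
      unfolding balance_factor_upper[OF that] r_def by simp
    also have "\<dots> = - (r v * (s - d * upper_pt v))"
      by (simp add: s algebra_simps)
    finally show ?thesis
      using derF[of "upper_pt v"] upper_pt_bounds[of v] that by (simp add: W'_def mult_ac)
  qed
  have "0 \<le> 2 * F p - F 0 - F 1"
  proof (rule nondecreasing_limits_le[of 0 H])
    fix v :: real assume v: "v > 0"
    note lo = lower_pt_bounds[of v] and up = upper_pt_bounds[of v]
    define l' where "l' = - (p\<^sup>2 / (v + p)\<^sup>2)"
    define u' where "u' = q\<^sup>2 / (v + q)\<^sup>2"
    have l: "DERIV lower_pt v :> l'" and u: "DERIV upper_pt v :> u'"
      using DERIV_lower_pt DERIV_upper_pt v by (auto simp: l'_def u'_def)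
    define c where "c = 2 * p * q / v\<^sup>2"
    have r: "DERIV r v :> - c"
      unfolding r_def c_def by (rule derivative_eq_intros refl | use v in force)+ (simp add: power2_eq_square)
    have Fl: "DERIV (\<lambda>v. F (lower_pt v)) v :> K * (r v * W' (lower_pt v)) * l'"
      by (rule DERIV_chain2[OF derF_lower[OF v] l])
    have Fu: "DERIV (\<lambda>v. F (upper_pt v)) v :> - (K * (r v * W' (upper_pt v))) * u'"
      by (rule DERIV_chain2[OF derF_upper[OF v] u])
    have Wl: "DERIV (\<lambda>v. W (lower_pt v)) v :> W' (lower_pt v) * l'"
      using v lo by (intro DERIV_chain2[OF derW l]) auto
    have Wu: "DERIV (\<lambda>v. W (upper_pt v)) v :> W' (upper_pt v) * u'"
      using v up by (intro DERIV_chain2[OF derW u]) auto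
    have "DERIV H v :> 0 - K * (r v * W' (lower_pt v)) * l' - - (K * (r v * W' (upper_pt v))) * u'
        + K * (- c * (W (lower_pt v) - W (upper_pt v))
             + (W' (lower_pt v) * l' - W' (upper_pt v) * u') * r v)"
      unfolding H_def
      by (rule DERIV_add[OF DERIV_diff[OF DERIV_diff[OF DERIV_const Fl] Fu]
            DERIV_cmult[OF DERIV_mult[OF r DERIV_diff[OF Wl Wu]]]])
    also have "0 - K * (r v * W' (lower_pt v)) * l' - - (K * (r v * W' (upper_pt v))) * u'
        + K * (- c * (W (lower_pt v) - W (upper_pt v))
             + (W' (lower_pt v) * l' - W' (upper_pt v) * u') * r v)
        = K * (c * (W (upper_pt v) - W (lower_pt v)))"
      by (simp add: algebra_simps)
    finally have "DERIV H v :> K * (c * (W (upper_pt v) - W (lower_pt v)))" .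
    moreover have "0 \<le> K * (c * (W (upper_pt v) - W (lower_pt v)))"
      using K p_pos q_pos weight_le[of v d] v d
      by (intro mult_nonneg_nonneg) (auto simp: W_def s t c_def)
    ultimately show "\<exists>D. DERIV H v :> D \<and> D \<ge> 0" by auto
  next
    let ?D = "\<lambda>v. W (lower_pt v) - W (upper_pt v)"
    have F_cont: "isCont F p" using derF[of p] pq by (auto intro: DERIV_isCont)
    \<comment> \<open>A vanishing derivative at \<open>0\<close> makes \<open>?D v / v\<close> tend to \<open>0\<close>, which compensates the pole of \<open>r\<close>.\<close>
    have "DERIV ?D 0 :> W' (lower_pt 0) * - (p\<^sup>2 / (0 + p)\<^sup>2) - W' (upper_pt 0) * (q\<^sup>2 / (0 + q)\<^sup>2)"
      using pq by (intro DERIV_diff DERIV_chain2[OF derW DERIV_lower_pt] DERIV_chain2[OF derW DERIV_upper_pt])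
         (auto simp: coupling_at_0)
    moreover have "W' p = 0" by (simp add: W'_def s)
    ultimately have D0: "DERIV ?D 0 :> 0" by (simp add: coupling_at_0)
    have "((\<lambda>v. ?D v / v) \<longlongrightarrow> 0) (at 0)"
      using D0 unfolding has_field_derivative_iff by (simp add: coupling_at_0)
    then have quot: "((\<lambda>v. ?D v / v) \<longlongrightarrow> 0) (at_right 0)"
      by (rule tendsto_mono[rotated]) (simp add: at_le)
    have "isCont ?D 0" using D0 by (rule DERIV_isCont)
    then have "(?D \<longlongrightarrow> 0) (at 0)" by (simp add: isCont_def coupling_at_0)
    then have "(?D \<longlongrightarrow> 0) (at_right 0)"
      by (rule tendsto_mono[rotated]) (simp add: at_le)
    then have "((\<lambda>v. 2 * F p - F (lower_pt v) - F (upper_pt v) + K * (?D v + 2 * p * q * (?D v / v)))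
        \<longlongrightarrow> 2 * F p - F p - F p + K * (0 + 2 * p * q * 0)) (at_right 0)"
      by (intro tendsto_intros quot isCont_tendsto_compose[OF F_cont] coupling_tendsto_0)
    then show "(H \<longlongrightarrow> 0) (at_right 0)"
      unfolding H_def r_def by (simp add: algebra_simps add_divide_distrib diff_divide_distrib)
  next
    have ev: "eventually (\<lambda>v. lower_pt v \<in> {0..1}) at_top" "eventually (\<lambda>v. upper_pt v \<in> {0..1}) at_top"
      using eventually_ge_at_top[of "0::real"]
      by (eventually_elim; use lower_pt_bounds upper_pt_bounds in \<open>auto intro: less_imp_le\<close>)+
    have lim: "((\<lambda>v. g (lower_pt v)) \<longlongrightarrow> g 0) at_top" "((\<lambda>v. g (upper_pt v)) \<longlongrightarrow> g 1) at_top"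
      if "continuous_on {0..1} g" for g :: "real \<Rightarrow> real"
      using continuous_on_tendsto_compose[OF that coupling_tendsto_top(1) _ ev(1)]
        continuous_on_tendsto_compose[OF that coupling_tendsto_top(2) _ ev(2)] by auto
    note limF = lim[of F, unfolded F_def, OF continuous_on_beta_tail_balance[OF s0 st(1)], folded F_def]
      and limW = lim[of W, unfolded W_def, OF continuous_on_beta_weight[OF s0 st(1)], folded W_def]
    have "(r \<longlongrightarrow> 1) at_top" unfolding r_def by real_asymp
    then have "(H \<longlongrightarrow> 2 * F p - F 0 - F 1 + K * (1 * (W 0 - W 1))) at_top"
      unfolding H_def by (intro tendsto_intros limF limW)
    then show "(H \<longlongrightarrow> 2 * F p - F 0 - F 1) at_top"
      using s0 st by (simp add: W_def beta_weight_def)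
  qed
  then show ?thesis
    using s0 st by (simp add: F_def beta_tail_balance_0 beta_tail_balance_1 p_def d_def)
qed

section \<open>The balance at (s + 1) / (s + t + 2)\<close>

text \<open>The product of the denominators \<open>b + aw\<close> and \<open>bw + a\<close> exceeds \<open>(a + b)\<^sup>2 w\<close> by \<open>ab (w - 1)\<^sup>2\<close>.\<close>

lemma reflected_fraction_ge:
  fixes a b w :: real
  assumes "0 < a" "a \<le> b" "0 < w"
  shows "- ((b - a) / ((a + b) * w)) \<le> a / (b + a * w) - b / (b * w + a)"
proof -
  have pos: "b + a * w > 0" "b * w + a > 0" using assms by (auto intro: add_pos_pos)
  have "(b + a * w) * (b * w + a) = (a + b)\<^sup>2 * w + a * b * (w - 1)\<^sup>2"
    by (simp add: algebra_simps power2_eq_square)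
  then have "(a + b)\<^sup>2 * w \<le> (b + a * w) * (b * w + a)"
    using assms by simp
  then have "(b - a) * (a + b) / ((b + a * w) * (b * w + a)) \<le> (b - a) * (a + b) / ((a + b)\<^sup>2 * w)"
    using assms pos by (intro divide_left_mono mult_pos_pos) auto
  also have "\<dots> = (b - a) / ((a + b) * w)"
    using assms by (simp add: power2_eq_square)
  also have "(b - a) * (a + b) / ((b + a * w) * (b * w + a)) = b / (b * w + a) - a / (b + a * w)"
    using pos by (simp add: diff_frac_eq) (simp add: algebra_simps)
  finally show ?thesis by simp
qed

text \<open>This is the logarithm of the ratio of the densities at two points whose odds are \<open>w\<close> times and \<open>1/w\<close>
  times the odds \<open>(s + 1)/(t + 1)\<close> of the centre.  It vanishes for \<open>w = 1\<close>, and bounding both differences of fractions in its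
  derivative by the previous lemma gives the lower bound
  \<open>(s - t)/w * (1 - (s + t + 1)/(s + t + 2) - 1/(2st + s + t))\<close>, which is nonnegative for \<open>st \<ge> 1\<close>.\<close>

lemma log_density_ratio_nonneg:
  fixes s t w :: real
  assumes st: "t \<ge> 1" "s \<ge> t" and w: "w \<ge> 1"
  shows "0 \<le> (s - t) * ln w
    + (s + t + 1) * (ln ((s + 1) + (t + 1) * w) - ln ((s + 1) * w + (t + 1)))
    + (ln (s * (t + 1) + t * (s + 1) * w) - ln (s * (t + 1) * w + t * (s + 1)))"
proof -
  define L where "L = (\<lambda>w. (s - t) * ln w
    + (s + t + 1) * (ln ((s + 1) + (t + 1) * w) - ln ((s + 1) * w + (t + 1)))
    + (ln (s * (t + 1) + t * (s + 1) * w) - ln (s * (t + 1) * w + t * (s + 1))))"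
  have "L 1 \<le> L w"
  proof (rule DERIV_nonneg_imp_nondecreasing[OF w])
    fix y :: real assume y: "1 \<le> y"
    have pos: "(s + 1) + (t + 1) * y > 0" "(s + 1) * y + (t + 1) > 0"
      "s * (t + 1) + t * (s + 1) * y > 0" "s * (t + 1) * y + t * (s + 1) > 0"
      using st y by (auto intro!: add_pos_pos mult_pos_pos)
    let ?A = "(t + 1) / ((s + 1) + (t + 1) * y) - (s + 1) / ((s + 1) * y + (t + 1))"
    let ?B = "t * (s + 1) / (s * (t + 1) + t * (s + 1) * y) - s * (t + 1) / (s * (t + 1) * y + t * (s + 1))"
    have "DERIV L y :> (s - t) / y + (s + t + 1) * ?A + ?B"
      unfolding L_def
      by (rule derivative_eq_intros refl | use pos y in force)+
    moreover have "0 \<le> (s - t) / y + (s + t + 1) * ?A + ?B"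
    proof -
      have "- ((s + 1 - (t + 1)) / ((t + 1 + (s + 1)) * y)) \<le> ?A"
        by (rule reflected_fraction_ge) (use st y in auto)
      then have "- ((s - t) / ((s + t + 2) * y)) \<le> ?A"
        by (simp add: algebra_simps)
      then have A: "(s + t + 1) * - ((s - t) / ((s + t + 2) * y)) \<le> (s + t + 1) * ?A"
        using st by (intro mult_left_mono) auto
      have "- ((s * (t + 1) - t * (s + 1)) / ((t * (s + 1) + s * (t + 1)) * y)) \<le> ?B"
        by (rule reflected_fraction_ge) (use st y in \<open>simp_all add: distrib_left add_pos_pos mult.commute\<close>)
      then have B: "- ((s - t) / ((2 * s * t + s + t) * y)) \<le> ?B"
        by (simp add: algebra_simps)
      have "s * t \<ge> 1" using st mult_mono[of 1 s 1 t] by simp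
      then have "s + t + 2 \<le> 2 * s * t + s + t" by simp
      then have "1 / (2 * s * t + s + t) \<le> 1 / (s + t + 2)"
        using st by (intro frac_le) linarith+
      then have "0 \<le> (s - t) / y * (1 / (s + t + 2) - 1 / (2 * s * t + s + t))"
        using st y by (intro mult_nonneg_nonneg) auto
      also have "1 / (s + t + 2) = 1 - (s + t + 1) / (s + t + 2)"
        using st by (simp add: field_simps)
      also have "(s - t) / y * (1 - (s + t + 1) / (s + t + 2) - 1 / (2 * s * t + s + t))
         = (s - t) / y + (s + t + 1) * - ((s - t) / ((s + t + 2) * y)) + - ((s - t) / ((2 * s * t + s + t) * y))"
        by (simp add: right_diff_distrib mult_ac)
      finally show ?thesis using A B by linarith
    qed
    ultimately show "\<exists>D. DERIV L y :> D \<and> D \<ge> 0" by auto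
  qed
  moreover have "L 1 = 0" by (simp add: L_def add_ac)
  ultimately show ?thesis by (simp add: L_def)
qed

text \<open>The previous inequality in exponential form, in the shape in which the derivatives of
  \<open>F\<close> along the two moving points produce it.\<close>

lemma weighted_density_le:
  fixes s t w :: real
  assumes st: "t \<ge> 1" "s \<ge> t" and w: "w \<ge> 1"
  shows "beta_weight s t ((s + 1) / ((s + 1) + (t + 1) * w))
           * ((s * (t + 1) * w + t * (s + 1)) / ((s + 1) + (t + 1) * w))
       \<le> beta_weight s t ((s + 1) * w / ((s + 1) * w + (t + 1)))
           * ((s * (t + 1) + t * (s + 1) * w) / ((s + 1) * w + (t + 1)))"
    (is "beta_weight s t ?x * (?M / ?m) \<le> beta_weight s t ?y * (?N / ?n)")
proof -
  have pos: "?m > 0" "?n > 0" "?M > 0" "?N > 0"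
    using st w by (auto intro!: add_pos_pos mult_pos_pos)
  have mn: "(t + 1) * w > 0" "(s + 1) * w > 0" "s + 1 > 0" "t + 1 > 0" "w > 0" using st w by auto
  have 1: "1 - ?x = (t + 1) * w / ?m" "1 - ?y = (t + 1) / ?n"
    using pos by (simp_all add: field_simps)
  have bw: "beta_weight s t z = exp (s * ln z + t * ln (1 - z))" if "0 < z" "0 < 1 - z" for z
    using that by (simp add: beta_weight_def powr_def exp_add)
  have xy: "0 < ?x" "0 < 1 - ?x" "0 < ?y" "0 < 1 - ?y"
    unfolding 1 by (intro divide_pos_pos pos mn)+
  have x: "beta_weight s t ?x * (?M / ?m) = exp (s * ln ?x + t * ln (1 - ?x) + (ln ?M - ln ?m))"
    unfolding bw[OF xy(1,2)] exp_add[of _ "ln ?M - ln ?m"] exp_diff exp_ln[OF pos(1)] exp_ln[OF pos(3)] ..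
  have y: "beta_weight s t ?y * (?N / ?n) = exp (s * ln ?y + t * ln (1 - ?y) + (ln ?N - ln ?n))"
    unfolding bw[OF xy(3,4)] exp_add[of _ "ln ?N - ln ?n"] exp_diff exp_ln[OF pos(2)] exp_ln[OF pos(4)] ..
  have logs: "ln ?x = ln (s + 1) - ln ?m" "ln ((t + 1) * w / ?m) = ln (t + 1) + ln w - ln ?m"
     "ln ?y = ln (s + 1) + ln w - ln ?n" "ln ((t + 1) / ?n) = ln (t + 1) - ln ?n"
    using mn pos(1)[THEN less_imp_neq, THEN not_sym] pos(2)[THEN less_imp_neq, THEN not_sym]
    by (simp_all add: ln_div ln_mult)
  have "s * ln ?x + t * ln (1 - ?x) + (ln ?M - ln ?m) \<le> s * ln ?y + t * ln (1 - ?y) + (ln ?N - ln ?n)"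
    using log_density_ratio_nonneg[OF assms] unfolding 1 logs
    by (simp add: algebra_simps)
  then show ?thesis unfolding x y by simp
qed

text \<open>The points \<open>x w\<close> and \<open>y w\<close> start at \<open>(s + 1)/(s + t + 2)\<close> for \<open>w = 1\<close> and reach \<open>0\<close> and \<open>1\<close> for
  \<open>w \<rightarrow> \<infinity>\<close>.  As \<open>F\<close> gains at least as much on the right as it loses on the left, \<open>F(x w) + F(y w)\<close>
  increases from twice the value in question to \<open>F(0) + F(1) = 2\<close>.\<close>

lemma beta_tail_balance_at_smoothed_mean_le_1:
  assumes st: "t \<ge> 1" "s \<ge> t"
  shows "beta_tail_balance s t ((s + 1) / (s + t + 2)) \<le> 1"
proof -
  define F where "F = beta_tail_balance s t"
  define W where "W = beta_weight s t"
  define K where "K = (s + t) / (s * t * Beta s t)"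
  define x where "x = (\<lambda>w. (s + 1) / ((s + 1) + (t + 1) * w))"
  define y where "y = (\<lambda>w. (s + 1) * w / ((s + 1) * w + (t + 1)))"
  have s0: "s > 0" "t > 0" using st by auto
  have K: "K \<ge> 0" using s0 Beta_real_pos[of s t] by (simp add: K_def)
  have m: "x 1 = (s + 1) / (s + t + 2)" "y 1 = (s + 1) / (s + t + 2)"
    by (simp_all add: x_def y_def add_ac)
  have pos: "(s + 1) + (t + 1) * w > 0" "(s + 1) * w + (t + 1) > 0" if "w \<ge> 1" for w
    using st that by (auto intro!: add_pos_pos mult_pos_pos)
  have compl: "1 - x w = (t + 1) * w / ((s + 1) + (t + 1) * w)"
      "1 - y w = (t + 1) / ((s + 1) * w + (t + 1))" if "w \<ge> 1" for w
    using pos[OF that] by (simp_all add: x_def y_def field_simps)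
  have pos01: "0 < x w" "0 < y w" "0 < 1 - x w" "0 < 1 - y w" if "w \<ge> 1" for w
    using pos[OF that] st that unfolding compl[OF that] by (simp_all add: x_def y_def)
  have bnd: "0 < x w" "x w < 1" "0 < y w" "y w < 1" if "w \<ge> 1" for w
    using pos01[OF that] by simp_all
  have derF: "DERIV F z :> K * (W z * (s * (1 - z) + t * z) / (z * (1 - z)))" if "0 < z" "z < 1" for z
    using DERIV_beta_tail_balance[OF s0 that] by (simp add: F_def W_def K_def)
  have Fx: "DERIV (\<lambda>w. F (x w)) w :>
      - (K / w * (W (x w) * ((s * (t + 1) * w + t * (s + 1)) / ((s + 1) + (t + 1) * w))))" if w: "w \<ge> 1" for w
  proof -
    let ?m = "(s + 1) + (t + 1) * w"
    have dx: "DERIV x w :> - ((s + 1) * (t + 1) / (?m * ?m))"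
      unfolding x_def by (rule derivative_eq_intros refl | use pos[OF w] in force)+
    have "?m \<noteq> 0" using pos[OF w] by simp
    then have "s * (1 - x w) + t * x w = (s * (t + 1) * w + t * (s + 1)) / ?m"
      "x w * (1 - x w) = (s + 1) * (t + 1) * w / (?m * ?m)"
      unfolding compl[OF w] unfolding x_def 
      by (simp_all only: times_divide_eq_right times_divide_eq_left divide_divide_eq_left
          add_divide_distrib[symmetric] mult_ac)
    then have "K * (W (x w) * (s * (1 - x w) + t * x w) / (x w * (1 - x w))) * - ((s + 1) * (t + 1) / (?m * ?m))
       = - (K / w * (W (x w) * ((s * (t + 1) * w + t * (s + 1)) / ?m)))"
      using st w \<open>?m \<noteq> 0\<close> by simp
    then show ?thesis
      using DERIV_chain2[OF derF[OF bnd(1,2)[OF w]] dx] by simp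
  qed
  have Fy: "DERIV (\<lambda>w. F (y w)) w :>
      K / w * (W (y w) * ((s * (t + 1) + t * (s + 1) * w) / ((s + 1) * w + (t + 1))))" if w: "w \<ge> 1" for w
  proof -
    let ?n = "(s + 1) * w + (t + 1)"
    have "DERIV y w :> ((s + 1) * ?n - (s + 1) * w * (s + 1)) / (?n * ?n)"
      unfolding y_def by (rule derivative_eq_intros refl | use pos[OF w] in force)+
    then have dy: "DERIV y w :> (s + 1) * (t + 1) / (?n * ?n)"
      by (simp add: algebra_simps)
    have "?n \<noteq> 0" using pos[OF w] by simp
    then have "s * (1 - y w) + t * y w = (s * (t + 1) + t * (s + 1) * w) / ?n"
      "y w * (1 - y w) = (s + 1) * (t + 1) * w / (?n * ?n)"
      unfolding compl[OF w] unfolding y_def 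
      by (simp_all only: times_divide_eq_right times_divide_eq_left divide_divide_eq_left
          add_divide_distrib[symmetric] mult_ac)
    then have "K * (W (y w) * (s * (1 - y w) + t * y w) / (y w * (1 - y w))) * ((s + 1) * (t + 1) / (?n * ?n))
       = K / w * (W (y w) * ((s * (t + 1) + t * (s + 1) * w) / ?n))"
      using st w \<open>?n \<noteq> 0\<close> by simp
    then show ?thesis
      using DERIV_chain2[OF derF[OF bnd(3,4)[OF w]] dy] by simp
  qed
  have der: "\<exists>D. DERIV (\<lambda>w. F (x w) + F (y w)) w :> D \<and> D \<ge> 0" if w: "w \<ge> 1" for w
  proof -
    have "W (x w) * ((s * (t + 1) * w + t * (s + 1)) / ((s + 1) + (t + 1) * w))
       \<le> W (y w) * ((s * (t + 1) + t * (s + 1) * w) / ((s + 1) * w + (t + 1)))"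
      using weighted_density_le[OF st w] by (simp add: W_def x_def y_def)
    then have "K / w * (W (x w) * ((s * (t + 1) * w + t * (s + 1)) / ((s + 1) + (t + 1) * w)))
       \<le> K / w * (W (y w) * ((s * (t + 1) + t * (s + 1) * w) / ((s + 1) * w + (t + 1))))"
      using K w by (intro mult_left_mono) auto
    then show ?thesis
      by - (rule exI, rule conjI, rule DERIV_add[OF Fx[OF w] Fy[OF w]], linarith)
  qed
  have "F (x 1) + F (y 1) \<le> F 0 + F 1"
  proof (rule nondecreasing_limits_le[of 1 "\<lambda>w. F (x w) + F (y w)"])
    show "\<exists>D. DERIV (\<lambda>w. F (x w) + F (y w)) w :> D \<and> D \<ge> 0" if "w > 1" for w
      using der that by simp
    obtain D where "DERIV (\<lambda>w. F (x w) + F (y w)) 1 :> D" using der[of 1] by auto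
    then have "isCont (\<lambda>w. F (x w) + F (y w)) 1" by (rule DERIV_isCont)
    then show "((\<lambda>w. F (x w) + F (y w)) \<longlongrightarrow> F (x 1) + F (y 1)) (at_right 1)"
      unfolding isCont_def by (rule tendsto_mono[rotated]) (simp add: at_le)
    have lim: "(x \<longlongrightarrow> 0) at_top" "(y \<longlongrightarrow> 1) at_top"
      unfolding x_def y_def using s0 by real_asymp+
    have ev: "eventually (\<lambda>w. x w \<in> {0..1}) at_top" "eventually (\<lambda>w. y w \<in> {0..1}) at_top"
      using eventually_ge_at_top[of "1::real"]
      by (eventually_elim; use bnd in \<open>auto intro: less_imp_le\<close>)+
    have contF: "continuous_on {0..1} F"
      unfolding F_def using s0 by (rule continuous_on_beta_tail_balance)
    show "((\<lambda>w. F (x w) + F (y w)) \<longlongrightarrow> F 0 + F 1) at_top"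
      using continuous_on_tendsto_compose[OF contF lim(1) _ ev(1)]
        continuous_on_tendsto_compose[OF contF lim(2) _ ev(2)]
      by (intro tendsto_add) auto
  qed
  then show ?thesis
    using s0 unfolding m by (simp add: F_def beta_tail_balance_0 beta_tail_balance_1)
qed

section \<open>Equipoint, beta tails and binomial tails\<close>

theorem theorem1p11:
  shows "(\<forall>d\<in>half_nats. \<forall>s\<in>half_nats. \<forall>t\<in>half_nats. s + t = d \<longrightarrow>
      (d / 2 \<le> s \<and> s < d \<longrightarrow>
         (\<forall>n::nat. s \<in> pos_nats \<and> t \<in> pos_nats \<and> d = real n \<longrightarrow>
            measure_pmf.prob (binomial_pmf n (s / d)) {k. real k < s}
              \<le> measure_pmf.prob (binomial_pmf n (s / d)) {k. real k > s}) \<and>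
         measure (beta_distr s (t + 1)) {x. x \<ge> s / d}
           \<le> measure (beta_distr (s + 1) t) {x. x \<le> s / d}) \<and>
      (\<forall>n::nat. s \<in> pos_nats \<and> t \<in> pos_nats \<and> d = real n \<longrightarrow>
         (measure_pmf.prob (binomial_pmf n (s / d)) {k. real k < s}
            \<le> measure_pmf.prob (binomial_pmf n (s / d)) {k. real k > s}
          \<longleftrightarrow> equipoint s t \<le> s / d)) \<and>
      (measure (beta_distr s (t + 1)) {x. x \<ge> s / d}
         \<le> measure (beta_distr (s + 1) t) {x. x \<le> s / d}
       \<longleftrightarrow> equipoint s t \<le> s / d)) \<and>
    (\<forall>s t::real. s \<ge> t \<and> t \<ge> 1 \<longrightarrow> (s + 1) / (s + t + 2) \<le> equipoint s t)"
proof (intro conjI ballI impI allI)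
  fix d s t :: real
  assume "s \<in> half_nats" "t \<in> half_nats" and d: "s + t = d"
  then have st: "s > 0" "t > 0" by (auto simp: half_nats_def)
  have p: "s / d \<in> {0..1}" using st d by auto
  have beta: "measure (beta_distr s (t + 1)) {x. x \<ge> s / d} \<le> measure (beta_distr (s + 1) t) {x. x \<le> s / d}
      \<longleftrightarrow> equipoint s t \<le> s / d"
    using beta_tails_le_iff[OF st p] equipoint_le_iff[OF st p] by simp
  have binom: "measure_pmf.prob (binomial_pmf n (s / d)) {k. real k < s}
          \<le> measure_pmf.prob (binomial_pmf n (s / d)) {k. real k > s}
        \<longleftrightarrow> equipoint s t \<le> s / d"
    if n: "s \<in> pos_nats \<and> t \<in> pos_nats \<and> d = real n" for n
  proof -
    obtain i j where ij: "s = real i" "t = real j" "1 \<le> i" "1 \<le> j"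
      using n by (auto simp: pos_nats_def)
    then have "n = i + j" using d n by simp
    then show ?thesis
      using binomial_tails_le_iff[OF ij(3,4), of n "s / d"] equipoint_le_iff[OF st p] p ij by simp
  qed
  show "measure (beta_distr s (t + 1)) {x. x \<ge> s / d} \<le> measure (beta_distr (s + 1) t) {x. x \<le> s / d}
      \<longleftrightarrow> equipoint s t \<le> s / d"
    by (rule beta)
  show "measure_pmf.prob (binomial_pmf n (s / d)) {k. real k < s}
          \<le> measure_pmf.prob (binomial_pmf n (s / d)) {k. real k > s}
        \<longleftrightarrow> equipoint s t \<le> s / d"
    if "s \<in> pos_nats \<and> t \<in> pos_nats \<and> d = real n" for n
    using that by (rule binom)
  assume "d / 2 \<le> s \<and> s < d"
  then have "t \<le> s" using d by simp
  from beta_tail_balance_at_mean_ge_1[OF st(2) this]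
  have le: "equipoint s t \<le> s / d"
    using equipoint_le_iff[OF st p] d by simp
  then show "measure (beta_distr s (t + 1)) {x. x \<ge> s / d} \<le> measure (beta_distr (s + 1) t) {x. x \<le> s / d}"
    using beta by simp
  show "measure_pmf.prob (binomial_pmf n (s / d)) {k. real k < s}
          \<le> measure_pmf.prob (binomial_pmf n (s / d)) {k. real k > s}"
    if "s \<in> pos_nats \<and> t \<in> pos_nats \<and> d = real n" for n
    using binom[OF that] le by simp
next
  fix s t :: real assume st: "s \<ge> t \<and> t \<ge> 1"
  then have "(s + 1) / (s + t + 2) \<in> {0..1}" by auto
  then show "(s + 1) / (s + t + 2) \<le> equipoint s t"
    using le_equipoint_iff[of s t] beta_tail_balance_at_smoothed_mean_le_1[of t s] st by simp
qed

end
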